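(* Let $G$ be an infinite countable discrete Abelian group with a F\o lner sequence $\mathbf{F}$. Then for every $G$-system $(X,G)$ the following statements are equivalent: (1) $(X,G)$ is weakly mixing; (2) for each admissible open cover $\mathcal{U}$ of $X$, there exists an infinite subset $S\subset G$ such that $h_{\mathrm{top}}^{S,\mathbf{F}}(G,\mathcal{U})=\log\mathcal{N}(\mathcal{U})$; (3) for each non-trivial finite open cover $\mathcal{U}$ of $X$, there exists an infinite subset $S\subset G$ such that $h_{\mathrm{top}}^{S,\mathbf{F}}(G,\mathcal{U})>0$; (4) for each standard open cover $\mathcal{U}$ of $X$, there exists an infinite subset $S\subset G$ such that $h_{\mathrm{top}}^{S,\mathbf{F}}(G,\mathcal{U})>0$.
   Context: The F\o lner sequence $\mathbf{F}=\{F_n\}_{n=1}^\infty$ is a sequence of finite subsets of $G$ with $\lim_{n\to\infty}|gF_n\triangle F_n|/|F_n|=0$ for every $g\in G$, $e_G\in F_1\subseteq F_2\subseteq\cdots$ and $\bigcup_n F_n=G$. A $G$-system $(X,G)$ is a compact metric space $X$ with a continuous action of $G$. For $U,V\subset X$ let $N(U,V)=\{g\in G:U\cap g^{-1}V\neq\emptyset\}$. The system $(X,G)$ is (topologically) weakly mixing if $N(U_1,V_1)\cap N(U_2,V_2)\neq\emptyset$ for any four nonempty open sets $U_1,U_2,V_1,V_2\subset X$. An open cover $\mathcal{U}=\{U_1,\ldots,U_n\}$ of $X$ is non-trivial if no $U_i$ is dense in $X$; a non-trivial open cover is standard if $n=2$. An open cover $\{U_i\}_{i\in I}$ is admissible if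 $U_i\setminus\bigcup_{j\in I,j\neq i}U_j$ has nonempty interior for each $i\in I$ (such a cover of a compact space is necessarily finite). For a finite open cover $\mathcal{U}$, $\mathcal{N}(\mathcal{U})$ is the minimal cardinality of a subcover, $g^{-1}\mathcal{U}=\{g^{-1}U:U\in\mathcal{U}\}$, and $\bigvee$ denotes the common refinement (the cover by intersections, one member from each cover). For an infinite subset $S\subset G$, $$h_{\mathrm{top}}^{S,\mathbf{F}}(G,\mathcal{U})=\limsup_{n\to\infty}\frac{1}{|S\cap F_n|}\log\mathcal{N}\Big(\bigvee_{g\in S\cap F_n}g^{-1}\mathcal{U}\Big).$$ *)

theory Defs
  imports "HOL-Analysis.Analysis" "HOL-Algebra.Group_Action"
begin

text \<open>The sequence \<open>F\<^sub>1, F\<^sub>2, \<dots>\<close> is indexed from \<open>0\<close> here.\<close>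

definition folner_sequence :: "('g, 'b) monoid_scheme \<Rightarrow> (nat \<Rightarrow> 'g set) \<Rightarrow> bool" where
  "folner_sequence G F \<longleftrightarrow>
     (\<forall>n. finite (F n) \<and> F n \<subseteq> carrier G) \<and>
     \<one>\<^bsub>G\<^esub> \<in> F 0 \<and>
     (\<forall>n. F n \<subseteq> F (Suc n)) \<and>
     (\<Union>n. F n) = carrier G \<and>
     (\<forall>g\<in>carrier G.
        (\<lambda>n. real (card (sym_diff (g <#\<^bsub>G\<^esub> F n) (F n))) / real (card (F n))) \<longlonglongrightarrow> 0)"

text \<open>The phase space is a whole type, hence nonempty. Continuity of the action is joint
  continuity, with \<open>G\<close> discrete.\<close>

definition G_system :: "('g, 'b) monoid_scheme \<Rightarrow> ('g \<Rightarrow> 'x \<Rightarrow> 'x::metric_space) \<Rightarrow> bool" where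
  "G_system G \<phi> \<longleftrightarrow>
     compact (UNIV :: 'x set) \<and>
     group_action G UNIV \<phi> \<and>
     continuous_map (prod_topology (discrete_topology (carrier G)) euclidean) euclidean
       (\<lambda>(g, x). \<phi> g x)"

definition hitting_set ::
  "('g, 'b) monoid_scheme \<Rightarrow> ('g \<Rightarrow> 'x \<Rightarrow> 'x) \<Rightarrow> 'x set \<Rightarrow> 'x set \<Rightarrow> 'g set" where
  "hitting_set G \<phi> U V = {g \<in> carrier G. U \<inter> \<phi> g -` V \<noteq> {}}"

definition weakly_mixing ::
  "('g, 'b) monoid_scheme \<Rightarrow> ('g \<Rightarrow> 'x \<Rightarrow> 'x::metric_space) \<Rightarrow> bool" where
  "weakly_mixing G \<phi> \<longleftrightarrow>
     (\<forall>U1 U2 V1 V2.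
        open U1 \<and> U1 \<noteq> {} \<and> open U2 \<and> U2 \<noteq> {} \<and> open V1 \<and> V1 \<noteq> {} \<and> open V2 \<and> V2 \<noteq> {} \<longrightarrow>
        hitting_set G \<phi> U1 V1 \<inter> hitting_set G \<phi> U2 V2 \<noteq> {})"

definition open_cover :: "'x::topological_space set set \<Rightarrow> bool" where
  "open_cover \<U> \<longleftrightarrow> (\<forall>U\<in>\<U>. open U) \<and> \<Union>\<U> = UNIV"

definition nontrivial_cover :: "'x::topological_space set set \<Rightarrow> bool" where
  "nontrivial_cover \<U> \<longleftrightarrow> finite \<U> \<and> open_cover \<U> \<and> (\<forall>U\<in>\<U>. closure U \<noteq> UNIV)"

definition standard_cover :: "'x::topological_space set set \<Rightarrow> bool" where
  "standard_cover \<U> \<longleftrightarrow> nontrivial_cover \<U> \<and> card \<U> = 2"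

text \<open>An indexed family with a repeated member is never admissible, so nothing is lost by
  treating admissible covers as sets of sets. Finiteness follows from compactness and is
  therefore not required.\<close>

definition admissible_cover :: "'x::topological_space set set \<Rightarrow> bool" where
  "admissible_cover \<U> \<longleftrightarrow> open_cover \<U> \<and> (\<forall>U\<in>\<U>. interior (U - \<Union>(\<U> - {U})) \<noteq> {})"

definition cover_number :: "'x set set \<Rightarrow> nat" where
  "cover_number \<U> = (LEAST n. \<exists>\<V>. \<V> \<subseteq> \<U> \<and> finite \<V> \<and> \<Union>\<V> = UNIV \<and> card \<V> = n)"

definition pullback_cover :: "('g \<Rightarrow> 'x \<Rightarrow> 'x) \<Rightarrow> 'g \<Rightarrow> 'x set set \<Rightarrow> 'x set set" where
  "pullback_cover \<phi> g \<U> = (\<lambda>U. \<phi> g -` U) ` \<U>"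

text \<open>The join over the empty index set is \<open>{UNIV}\<close>.\<close>

definition cover_join :: "'g set \<Rightarrow> ('g \<Rightarrow> 'x set set) \<Rightarrow> 'x set set" where
  "cover_join T \<C> = {\<Inter>g\<in>T. c g | c. \<forall>g\<in>T. c g \<in> \<C> g}"

text \<open>For infinite \<open>S\<close> and a Folner sequence \<open>F\<close>, the set \<open>S \<inter> F n\<close> is empty for at most
  finitely many \<open>n\<close>, so division by zero does not affect the value.\<close>

definition seq_entropy ::
  "('g \<Rightarrow> 'x \<Rightarrow> 'x) \<Rightarrow> (nat \<Rightarrow> 'g set) \<Rightarrow> 'g set \<Rightarrow> 'x set set \<Rightarrow> ereal" where
  "seq_entropy \<phi> F S \<U> =
     limsup (\<lambda>n. ereal (1 / real (card (S \<inter> F n)) *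
       ln (real (cover_number (cover_join (S \<inter> F n) (\<lambda>g. pullback_cover \<phi> g \<U>))))))"

end

theory Submission
  imports Defs "HOL-Real_Asymp.Real_Asymp"
begin

text \<open>
  Weak mixing and commutativity give an infinite \<open>S\<close> such that every assignment of
  sets from a given finite family of nonempty open sets to finitely many \<open>s \<in> S\<close> is realised
  by an orbit. Counting the points realising the words over the family shows that joins along
  \<open>S\<close> have exponentially many members, exactly \<open>card \<U> ^ n\<close> in the admissible case.
  Conversely, if \<open>X\<close> is not weakly mixing, then \<open>N(U, U)\<close> and \<open>N(U, V)\<close> are disjoint for
  some \<open>U\<close>, \<open>V\<close>. For closed balls \<open>A \<subseteq> U\<close>, \<open>B \<subseteq> V\<close> no two group elements are then
  independent for \<open>(A, B)\<close>, so by a Sauer--Shelah type count for partially labelled points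
  the join of \<open>n\<close> translates of \<open>{- A, - B}\<close> has a subcover of size \<open>n ^ O(log n)\<close>, and
  the standard cover \<open>{- A, - B}\<close> has zero entropy along every infinite \<open>S\<close>.
\<close>

section \<open>Cover numbers of joins\<close>

lemma cover_number_le:
  "\<V> \<subseteq> \<U> \<Longrightarrow> finite \<V> \<Longrightarrow> \<Union>\<V> = UNIV \<Longrightarrow> cover_number \<U> \<le> card \<V>"
  unfolding cover_number_def by (rule Least_le) blast

lemma minimal_subcover:
  assumes "finite \<U>" "\<Union>\<U> = UNIV"
  obtains \<V> where "\<V> \<subseteq> \<U>" "finite \<V>" "\<Union>\<V> = UNIV" "card \<V> = cover_number \<U>"
proof -
  have "\<exists>n \<V>. \<V> \<subseteq> \<U> \<and> finite \<V> \<and> \<Union>\<V> = UNIV \<and> card \<V> = n"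
    using assms by blast
  from LeastI_ex[OF this] show ?thesis
    using that unfolding cover_number_def by blast
qed

lemma cover_number_pos:
  assumes "finite \<U>" "\<Union>\<U> = UNIV"
  shows "cover_number \<U> > 0"
  using minimal_subcover[OF assms]
  by (metis Sup_empty UNIV_not_empty card_gt_0_iff)

text \<open>Extensional choice functions make the members of the join countable through
  \<open>card_PiE\<close>. Different functions may give the same member, which is harmless for upper
  bounds.\<close>

lemma cover_join_pullback:
  "cover_join T (\<lambda>g. pullback_cover \<phi> g \<U>) =
     (\<lambda>c. \<Inter>g\<in>T. \<phi> g -` c g) ` (T \<rightarrow>\<^sub>E \<U>)" (is "?L = ?R")
proof
  show "?L \<subseteq> ?R"
  proof
    fix D assume "D \<in> ?L"
    then obtain c where D: "D = (\<Inter>g\<in>T. c g)" and c: "\<forall>g\<in>T. \<exists>U\<in>\<U>. c g = \<phi> g -` U"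
      unfolding cover_join_def pullback_cover_def image_iff by auto
    from c obtain u where u: "\<And>g. g \<in> T \<Longrightarrow> u g \<in> \<U> \<and> c g = \<phi> g -` u g"
      by metis
    have "D = (\<Inter>g\<in>T. \<phi> g -` restrict u T g)" "restrict u T \<in> T \<rightarrow>\<^sub>E \<U>"
      using D u by auto
    then show "D \<in> ?R" by blast
  qed
  show "?R \<subseteq> ?L"
  proof
    fix D assume "D \<in> ?R"
    then obtain u where "D = (\<Inter>g\<in>T. \<phi> g -` u g)" "u \<in> T \<rightarrow>\<^sub>E \<U>"
      by blast
    then show "D \<in> ?L"
      unfolding cover_join_def pullback_cover_def
      by (intro CollectI exI[of _ "\<lambda>g. \<phi> g -` u g"]) auto
  qed
qed

lemma finite_cover_join:
  "finite T \<Longrightarrow> finite \<U> \<Longrightarrow> finite (cover_join T (\<lambda>g. pullback_cover \<phi> g \<U>))"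
  unfolding cover_join_pullback by (intro finite_imageI finite_PiE) auto

lemma Union_cover_join:
  assumes "\<Union>\<U> = UNIV"
  shows "\<Union>(cover_join T (\<lambda>g. pullback_cover \<phi> g \<U>)) = UNIV"
proof -
  have "x \<in> \<Union>(cover_join T (\<lambda>g. pullback_cover \<phi> g \<U>))" for x
  proof -
    have "\<forall>g. \<exists>U\<in>\<U>. \<phi> g x \<in> U" using assms by blast
    then obtain u where "\<And>g. u g \<in> \<U> \<and> \<phi> g x \<in> u g" by metis
    then have "restrict u T \<in> T \<rightarrow>\<^sub>E \<U>" "x \<in> (\<Inter>g\<in>T. \<phi> g -` restrict u T g)"
      by auto
    then show ?thesis unfolding cover_join_pullback by blast
  qed
  then show ?thesis by blast
qed

lemma cover_number_join_le:
  assumes "finite T" "finite \<U>" "\<Union>\<U> = UNIV"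
  shows "cover_number (cover_join T (\<lambda>g. pullback_cover \<phi> g \<U>)) \<le> card \<U> ^ card T"
proof -
  have "cover_number (cover_join T (\<lambda>g. pullback_cover \<phi> g \<U>))
      \<le> card (cover_join T (\<lambda>g. pullback_cover \<phi> g \<U>))"
    using assms by (intro cover_number_le finite_cover_join Union_cover_join) auto
  also have "\<dots> \<le> card (T \<rightarrow>\<^sub>E \<U>)"
    unfolding cover_join_pullback using assms by (intro card_image_le finite_PiE) auto
  also have "\<dots> = card \<U> ^ card T"
    using assms(1) by (simp add: card_PiE)
  finally show ?thesis .
qed

lemma cover_number_join_pos:
  assumes "finite T" "finite \<U>" "\<Union>\<U> = UNIV"
  shows "cover_number (cover_join T (\<lambda>g. pullback_cover \<phi> g \<U>)) > 0"
  using assms by (intro cover_number_pos finite_cover_join Union_cover_join)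

lemma cover_number_join_ge:
  assumes T: "finite T" and \<U>: "finite \<U>" "\<Union>\<U> = UNIV"
    and indep: "\<And>w. w \<in> T \<rightarrow> W ` \<U> \<Longrightarrow> \<exists>x. \<forall>t\<in>T. \<phi> t x \<in> w t"
    and m: "\<And>U. U \<in> \<U> \<Longrightarrow> card {V \<in> \<U>. W V \<inter> U \<noteq> {}} \<le> m"
  shows "card \<U> ^ card T \<le> m ^ card T * cover_number (cover_join T (\<lambda>g. pullback_cover \<phi> g \<U>))"
proof -
  let ?J = "cover_join T (\<lambda>g. pullback_cover \<phi> g \<U>)"
  obtain \<V> where \<V>: "\<V> \<subseteq> ?J" "finite \<V>" "\<Union>\<V> = UNIV" "card \<V> = cover_number ?J"
    by (rule minimal_subcover[OF finite_cover_join[OF T \<U>(1)] Union_cover_join[OF \<U>(2)]])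
  have "\<exists>x. \<forall>t\<in>T. \<phi> t x \<in> W (w t)" if "w \<in> T \<rightarrow>\<^sub>E \<U>" for w
    using that by (intro indep) auto
  then obtain p where p: "\<And>w t. w \<in> T \<rightarrow>\<^sub>E \<U> \<Longrightarrow> t \<in> T \<Longrightarrow> \<phi> t (p w) \<in> W (w t)"
    by metis
  have small: "card {w \<in> T \<rightarrow>\<^sub>E \<U>. p w \<in> D} \<le> m ^ card T" if "D \<in> \<V>" for D
  proof -
    obtain c where c: "c \<in> T \<rightarrow>\<^sub>E \<U>" and D: "D = (\<Inter>g\<in>T. \<phi> g -` c g)"
      using \<open>D \<in> \<V>\<close> \<V>(1) unfolding cover_join_pullback by blast
    \<comment> \<open>If \<open>p w\<close> lies in \<open>D\<close>, then
      \<open>\<phi> t (p w)\<close> lies both in \<open>W (w t)\<close> and in \<open>c t\<close>,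
      so these two sets meet at every \<open>t\<close>.\<close>
    have "{w \<in> T \<rightarrow>\<^sub>E \<U>. p w \<in> D} \<subseteq> (\<Pi>\<^sub>E t\<in>T. {V \<in> \<U>. W V \<inter> c t \<noteq> {}})"
    proof
      fix w assume "w \<in> {w \<in> T \<rightarrow>\<^sub>E \<U>. p w \<in> D}"
      then have w: "w \<in> T \<rightarrow>\<^sub>E \<U>" and "p w \<in> D" by auto
      then have "W (w t) \<inter> c t \<noteq> {}" if "t \<in> T" for t
        using p[OF w that] D that by auto
      then show "w \<in> (\<Pi>\<^sub>E t\<in>T. {V \<in> \<U>. W V \<inter> c t \<noteq> {}})"
        using w by (auto simp: PiE_iff)
    qed
    then have "card {w \<in> T \<rightarrow>\<^sub>E \<U>. p w \<in> D} \<le> card (\<Pi>\<^sub>E t\<in>T. {V \<in> \<U>. W V \<inter> c t \<noteq> {}})"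
      using T \<U>(1) by (intro card_mono finite_PiE) auto
    also have "\<dots> = (\<Prod>t\<in>T. card {V \<in> \<U>. W V \<inter> c t \<noteq> {}})"
      using T by (simp add: card_PiE)
    also have "\<dots> \<le> (\<Prod>t\<in>T. m)"
      using c by (intro prod_mono) (auto intro!: m)
    finally show ?thesis by simp
  qed
  have "card \<U> ^ card T = card (T \<rightarrow>\<^sub>E \<U>)"
    using T by (simp add: card_PiE)
  also have "\<dots> = card (\<Union>D\<in>\<V>. {w \<in> T \<rightarrow>\<^sub>E \<U>. p w \<in> D})"
    using \<V>(3) by (intro arg_cong[where f = card]) auto
  also have "\<dots> \<le> (\<Sum>D\<in>\<V>. card {w \<in> T \<rightarrow>\<^sub>E \<U>. p w \<in> D})"
    by (rule card_UN_le[OF \<V>(2)])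
  also have "\<dots> \<le> (\<Sum>D\<in>\<V>. m ^ card T)"
    by (intro sum_mono small)
  finally show ?thesis using \<V>(4) by (simp add: mult.commute)
qed

section \<open>Shattering\<close>

text \<open>\<open>A t\<close> and \<open>B t\<close> need not exhaust the space, so this is
  independence for pairs of sets rather than classical shattering. The point set \<open>Y\<close> is
  a parameter because inductions restrict it to \<open>Y \<inter> A s\<close> and
  \<open>Y \<inter> B s\<close>. The empty index set is shattered exactly when \<open>Y\<close> is
  nonempty.\<close>

definition shattered :: "('t \<Rightarrow> 'x set) \<Rightarrow> ('t \<Rightarrow> 'x set) \<Rightarrow> 'x set \<Rightarrow> 't set \<Rightarrow> 't set set" where
  "shattered A B Y T =
     {R. R \<subseteq> T \<and> (\<forall>Q\<subseteq>R. \<exists>y\<in>Y. (\<forall>t\<in>Q. y \<in> A t) \<and> (\<forall>t\<in>R - Q. y \<in> B t))}"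

lemma finite_shattered: "finite T \<Longrightarrow> finite (shattered A B Y T)"
  by (rule finite_subset[of _ "Pow T"]) (auto simp: shattered_def)

lemma shattered_mono: "Y \<subseteq> Y' \<Longrightarrow> T \<subseteq> T' \<Longrightarrow> shattered A B Y T \<subseteq> shattered A B Y' T'"
  unfolding shattered_def
  by (intro Collect_mono conj_mono impI; use subsetD[of Y Y'] in \<open>auto; meson\<close>)

text \<open>A pattern \<open>Q\<close> containing \<open>s\<close> is realised by a point of
  \<open>Y \<inter> A s\<close>, any other pattern by a point of
  \<open>Y \<inter> B s\<close>.\<close>

lemma insert_shattered:
  assumes "R \<in> shattered A B (Y \<inter> A s) T" "R \<in> shattered A B (Y \<inter> B s) T" "s \<notin> T"
  shows "insert s R \<in> shattered A B Y (insert s T)"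
  unfolding shattered_def
proof (intro CollectI conjI allI impI)
  show "insert s R \<subseteq> insert s T"
    using assms unfolding shattered_def by auto
  have s: "s \<notin> R" using assms unfolding shattered_def by auto
  fix Q assume Q: "Q \<subseteq> insert s R"
  show "\<exists>y\<in>Y. (\<forall>t\<in>Q. y \<in> A t) \<and> (\<forall>t\<in>insert s R - Q. y \<in> B t)"
  proof (cases "s \<in> Q")
    case True
    have "Q - {s} \<subseteq> R" using Q by auto
    then obtain y where "y \<in> Y \<inter> A s" "\<forall>t\<in>Q - {s}. y \<in> A t" "\<forall>t\<in>R - (Q - {s}). y \<in> B t"
      using assms(1) unfolding shattered_def by blast
    then show ?thesis using True by (intro bexI[of _ y]) auto
  next
    case False
    then have "Q \<subseteq> R" using Q by auto
    then obtain y where "y \<in> Y \<inter> B s" "\<forall>t\<in>Q. y \<in> A t" "\<forall>t\<in>R - Q. y \<in> B t"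
      using assms(2) unfolding shattered_def by blast
    then show ?thesis by (intro bexI[of _ y]) auto
  qed
qed

text \<open>Pajor's counting: a set \<open>R\<close> shattered by both halves is counted twice on
  the left, and \<open>insert s R\<close> pays for the second count. These sets are new, since
  nothing in the two families contains \<open>s\<close>.\<close>

lemma card_shattered_split:
  assumes "finite T" "s \<notin> T"
  shows "card (shattered A B (Y \<inter> A s) T) + card (shattered A B (Y \<inter> B s) T)
           \<le> card (shattered A B Y (insert s T))"
proof -
  let ?a = "shattered A B (Y \<inter> A s) T" and ?b = "shattered A B (Y \<inter> B s) T"
  have fin: "finite ?a" "finite ?b" using assms(1) by (auto intro: finite_shattered)
  have s: "s \<notin> R" if "R \<in> ?a \<union> ?b" for R
    using that assms(2) unfolding shattered_def by auto
  have inj: "inj_on (insert s) (?a \<inter> ?b)"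
    using s by (intro inj_onI) (metis IntD1 UnI1 insert_ident)
  have "card ?a + card ?b = card (?a \<union> ?b) + card (insert s ` (?a \<inter> ?b))"
    using card_Un_Int[OF fin] card_image[OF inj] by simp
  also have "\<dots> = card (?a \<union> ?b \<union> insert s ` (?a \<inter> ?b))"
    using fin s by (intro card_Un_disjoint[symmetric]) auto
  also have "\<dots> \<le> card (shattered A B Y (insert s T))"
  proof (intro card_mono finite_shattered)
    show "?a \<union> ?b \<union> insert s ` (?a \<inter> ?b) \<subseteq> shattered A B Y (insert s T)"
      using insert_shattered[OF _ _ assms(2)] shattered_mono[of "Y \<inter> A s" Y T "insert s T" A B]
        shattered_mono[of "Y \<inter> B s" Y T "insert s T" A B] by blast
  qed (use assms in auto)
  finally show ?thesis .
qed

text \<open>\<open>Q\<close> is the set of indices with label A. Where a point lies in neither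
  \<open>A t\<close> nor \<open>B t\<close> it imposes no condition, and this freedom is what
  permits a default label.\<close>

definition labels :: "('t \<Rightarrow> 'x set) \<Rightarrow> ('t \<Rightarrow> 'x set) \<Rightarrow> 't set \<Rightarrow> 't set \<Rightarrow> 'x \<Rightarrow> bool" where
  "labels A B T Q y \<longleftrightarrow> (\<forall>t\<in>T. (y \<in> A t \<longrightarrow> t \<in> Q) \<and> (y \<in> B t \<longrightarrow> t \<notin> Q))"

text \<open>At each index one of the two labels at most halves the number of shattered sets, so
  at most \<open>j\<close> times a point disagrees with the other, default label.\<close>

lemma labelling_bound:
  assumes "finite T" "\<And>t. t \<in> T \<Longrightarrow> A t \<inter> B t = {}" "card (shattered A B Y T) < 2 ^ j"
  shows "\<exists>C. finite C \<and> card C \<le> (card T + 1) ^ j \<and> (\<forall>y\<in>Y. \<exists>Q\<in>C. labels A B T Q y)"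
  using assms
proof (induction T arbitrary: Y j rule: finite_induct)
  case empty
  then show ?case
    by (intro exI[of _ "{{}}"]) (auto simp: labels_def)
next
  case (insert s T)
  show ?case
  proof (cases j)
    \<comment> \<open>Here the bound is 1, so not even the empty set is shattered; hence there are
      no points and no labellings are needed.\<close>
    case 0
    then have "shattered A B Y (insert s T) = {}"
      using insert.prems(2) insert.hyps(1) finite_shattered[of "insert s T" A B Y] by simp
    then have "{} \<notin> shattered A B Y (insert s T)" by simp
    then have "Y = {}" unfolding shattered_def by auto
    then show ?thesis by (intro exI[of _ "{}"]) auto
  next
    case (Suc i)
    have bound: "card (shattered A B (Y \<inter> A s) T) + card (shattered A B (Y \<inter> B s) T) < 2 ^ Suc i"
      using card_shattered_split[OF insert.hyps, of A B Y] insert.prems(2) Suc by simp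
    have disj: "\<And>t. t \<in> T \<Longrightarrow> A t \<inter> B t = {}" and sdisj: "A s \<inter> B s = {}"
      using insert.prems(1) by auto
    have "card (shattered A B Y T) \<le> card (shattered A B Y (insert s T))"
      using insert.hyps(1) by (intro card_mono finite_shattered shattered_mono) auto
    then have "card (shattered A B Y T) < 2 ^ Suc i" using insert.prems(2) Suc by simp
    from insert.IH[OF disj this] obtain C where C: "finite C" "card C \<le> (card T + 1) ^ Suc i"
      "\<forall>y\<in>Y. \<exists>Q\<in>C. labels A B T Q y" by blast
    \<comment> \<open>The two terms are the sizes allowed for labellings following the default at
      \<open>s\<close> and for those deviating from it; only the latter use up one unit of the
      exponent.\<close>
    have arith: "(card T + 1) ^ Suc i + (card T + 1) ^ i \<le> (card (insert s T) + 1) ^ j"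
    proof -
      have "(card T + 1) ^ Suc i + (card T + 1) ^ i = (card T + 2) * (card T + 1) ^ i" by simp
      also have "\<dots> \<le> (card T + 2) * (card T + 2) ^ i"
        by (intro mult_le_mono2 power_mono) auto
      finally show ?thesis using insert.hyps Suc by simp
    qed
    have card: "card ((f ` C) \<union> (g ` D)) \<le> (card (insert s T) + 1) ^ j"
      if "finite D" "card D \<le> (card T + 1) ^ i" for f g :: "'a set \<Rightarrow> 'a set" and D
    proof -
      have "card ((f ` C) \<union> (g ` D)) \<le> card C + card D"
        using card_Un_le[of "f ` C" "g ` D"] card_image_le[OF C(1), of f]
          card_image_le[OF that(1), of g] by linarith
      then show ?thesis using C(2) that(2) arith by linarith
    qed
    consider "card (shattered A B (Y \<inter> A s) T) < 2 ^ i" | "card (shattered A B (Y \<inter> B s) T) < 2 ^ i"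
      using bound by fastforce
    then show ?thesis
    proof cases
      case 1
      from insert.IH[OF disj this] obtain D where D: "finite D" "card D \<le> (card T + 1) ^ i"
        "\<forall>y\<in>Y \<inter> A s. \<exists>Q\<in>D. labels A B T Q y" by blast
      \<comment> \<open>The default label at \<open>s\<close> is B. It suits every point outside
        \<open>A s\<close>, and the points in \<open>A s\<close> are served by the smaller family
        \<open>D\<close>.\<close>
      let ?C = "(\<lambda>Q. Q - {s}) ` C \<union> insert s ` D"
      have "\<exists>Q\<in>?C. labels A B (insert s T) Q y" if "y \<in> Y" for y
      proof (cases "y \<in> A s")
        case True
        then obtain Q where "Q \<in> D" "labels A B T Q y" using D(3) \<open>y \<in> Y\<close> by blast
        then show ?thesis using True sdisj insert.hyps(2)
          by (intro bexI[of _ "insert s Q"]) (auto simp: labels_def)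
      next
        case False
        then obtain Q where "Q \<in> C" "labels A B T Q y" using C(3) \<open>y \<in> Y\<close> by blast
        then show ?thesis using False insert.hyps(2)
          by (intro bexI[of _ "Q - {s}"]) (auto simp: labels_def)
      qed
      then show ?thesis using card[OF D(1,2)] C(1) D(1) by (intro exI[of _ ?C]) auto
    next
      case 2
      from insert.IH[OF disj this] obtain D where D: "finite D" "card D \<le> (card T + 1) ^ i"
        "\<forall>y\<in>Y \<inter> B s. \<exists>Q\<in>D. labels A B T Q y" by blast
      \<comment> \<open>The mirror image: the default label at \<open>s\<close> is A, and
        \<open>D\<close> serves the points in \<open>B s\<close>.\<close>
      let ?C = "insert s ` C \<union> (\<lambda>Q. Q - {s}) ` D"
      have "\<exists>Q\<in>?C. labels A B (insert s T) Q y" if "y \<in> Y" for y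
      proof (cases "y \<in> B s")
        case True
        then obtain Q where "Q \<in> D" "labels A B T Q y" using D(3) \<open>y \<in> Y\<close> by blast
        then show ?thesis using True sdisj insert.hyps(2)
          by (intro bexI[of _ "Q - {s}"]) (auto simp: labels_def)
      next
        case False
        then obtain Q where "Q \<in> C" "labels A B T Q y" using C(3) \<open>y \<in> Y\<close> by blast
        then show ?thesis using False insert.hyps(2)
          by (intro bexI[of _ "insert s Q"]) (auto simp: labels_def)
      qed
      then show ?thesis using card[OF D(1,2)] C(1) D(1) by (intro exI[of _ ?C]) auto
    qed
  qed
qed

lemma cover_number_join_le_shattered:
  assumes T: "finite T" and disj: "A \<inter> B = {}"
    and j: "card (shattered (\<lambda>t. \<phi> t -` A) (\<lambda>t. \<phi> t -` B) UNIV T) < 2 ^ j"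
  shows "cover_number (cover_join T (\<lambda>g. pullback_cover \<phi> g {- A, - B})) \<le> (card T + 1) ^ j"
proof -
  let ?A = "\<lambda>t. \<phi> t -` A" and ?B = "\<lambda>t. \<phi> t -` B"
  have "\<exists>C. finite C \<and> card C \<le> (card T + 1) ^ j \<and> (\<forall>y\<in>UNIV. \<exists>Q\<in>C. labels ?A ?B T Q y)"
    using disj by (intro labelling_bound T j) auto
  then obtain C where C: "finite C" "card C \<le> (card T + 1) ^ j"
    "\<And>y. \<exists>Q\<in>C. labels ?A ?B T Q y" by blast
  \<comment> \<open>A point labelled by \<open>Q\<close> avoids \<open>B\<close> at indices in
    \<open>Q\<close> and \<open>A\<close> at the others, so \<open>Q\<close> names a member of the
    join containing it.\<close>
  define D where "D Q = (\<Inter>t\<in>T. \<phi> t -` restrict (\<lambda>t. if t \<in> Q then - B else - A) T t)" for Q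
  have "cover_number (cover_join T (\<lambda>g. pullback_cover \<phi> g {- A, - B})) \<le> card (D ` C)"
  proof (rule cover_number_le)
    show "D ` C \<subseteq> cover_join T (\<lambda>g. pullback_cover \<phi> g {- A, - B})"
      unfolding cover_join_pullback
    proof (rule image_subsetI)
      fix Q
      show "D Q \<in> (\<lambda>c. \<Inter>g\<in>T. \<phi> g -` c g) ` (T \<rightarrow>\<^sub>E {- A, - B})"
        by (rule image_eqI[of _ _ "\<lambda>t\<in>T. if t \<in> Q then - B else - A"])
          (simp_all add: D_def restrict_PiE_iff)
    qed
    have "\<exists>Q\<in>C. y \<in> D Q" for y
    proof -
      obtain Q where "Q \<in> C" "labels ?A ?B T Q y" using C(3) by blast
      then show ?thesis
        unfolding labels_def D_def by (intro bexI[of _ Q]) auto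
    qed
    then show "\<Union>(D ` C) = UNIV" by blast
  qed (use C in auto)
  also have "\<dots> \<le> (card T + 1) ^ j"
    using card_image_le[OF C(1), of D] C(2) by linarith
  finally show ?thesis .
qed

section \<open>Abelian group systems\<close>

lemma finite_subset_incseq:
  assumes "incseq A" "finite T" "T \<subseteq> (\<Union>n. A n)"
  shows "\<exists>n. T \<subseteq> A n"
  using assms(2,3)
proof (induction T rule: finite_induct)
  case (insert t T)
  then obtain m n where "T \<subseteq> A m" "t \<in> A n" by auto
  then have "insert t T \<subseteq> A (max m n)"
    using incseqD[OF assms(1), of m "max m n"] incseqD[OF assms(1), of n "max m n"] by auto
  then show ?case ..
qed simp

locale abelian_system = comm_group G for G (structure) +
  fixes \<phi> :: "'a \<Rightarrow> 'x \<Rightarrow> 'x::metric_space"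
  assumes system: "G_system G \<phi>"
begin

lemma act_one: "\<phi> \<one> x = x"
  using system group_action.id_eq_one[of G UNIV \<phi>] unfolding G_system_def
  by (metis UNIV_I restrict_apply)

lemma act_mult: "g \<in> carrier G \<Longrightarrow> h \<in> carrier G \<Longrightarrow> \<phi> (g \<otimes> h) x = \<phi> g (\<phi> h x)"
  using system group_action.composition_rule[of G UNIV \<phi> x g h] unfolding G_system_def by auto

lemma open_vimage_act:
  assumes "g \<in> carrier G" "open U"
  shows "open (\<phi> g -` U)"
proof -
  have "continuous_map euclidean (prod_topology (discrete_topology (carrier G)) euclidean)
      (\<lambda>x. (g, x))"
    using assms(1) by (intro continuous_map_pairedI) auto
  then have "continuous_map euclidean euclidean ((\<lambda>(g, x). \<phi> g x) \<circ> (\<lambda>x. (g, x)))"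
    using system unfolding G_system_def by (blast intro: continuous_map_compose)
  then have "continuous_on UNIV (\<phi> g)" by (simp add: o_def)
  then show ?thesis using assms(2) by (rule open_vimage[rotated])
qed

section \<open>Hitting sets, and independent sets from weak mixing\<close>

lemma hitting_setI:
  "g \<in> carrier G \<Longrightarrow> x \<in> U \<Longrightarrow> \<phi> g x \<in> V \<Longrightarrow> g \<in> hitting_set G \<phi> U V"
  unfolding hitting_set_def by auto

lemma hitting_setE:
  assumes "g \<in> hitting_set G \<phi> U V"
  obtains x where "g \<in> carrier G" "x \<in> U" "\<phi> g x \<in> V"
  using assms unfolding hitting_set_def by auto

lemma hitting_set_mono:
  "U \<subseteq> U' \<Longrightarrow> V \<subseteq> V' \<Longrightarrow> hitting_set G \<phi> U V \<subseteq> hitting_set G \<phi> U' V'"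
  unfolding hitting_set_def by auto

text \<open>Commutativity of the group enters here: \<open>\<phi> g\<close> and
  \<open>\<phi> a\<close> commute, so \<open>\<phi> a\<close> carries a hit between the preimages to
  a hit between the sets.\<close>

lemma hitting_set_vimage:
  assumes "a \<in> carrier G"
  shows "hitting_set G \<phi> (\<phi> a -` U) (\<phi> a -` V) \<subseteq> hitting_set G \<phi> U V"
proof
  fix g assume "g \<in> hitting_set G \<phi> (\<phi> a -` U) (\<phi> a -` V)"
  then obtain x where g: "g \<in> carrier G" and x: "\<phi> a x \<in> U" "\<phi> a (\<phi> g x) \<in> V"
    by (auto elim: hitting_setE)
  have "\<phi> g (\<phi> a x) = \<phi> a (\<phi> g x)"
    using act_mult[OF g assms] act_mult[OF assms g] m_comm[OF g assms] by metis
  then show "g \<in> hitting_set G \<phi> U V"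
    using g x by (auto intro: hitting_setI)
qed

text \<open>Furstenberg's intersection argument: by weak mixing a single \<open>a\<close> moves part
  of \<open>U\<close> into \<open>U'\<close> and part of \<open>V\<close> into \<open>V'\<close>.
  Shrinking to those parts absorbs one more pair.\<close>

lemma weakly_mixing_hitting_common:
  assumes wm: "weakly_mixing G \<phi>" and "finite \<P>"
    and "\<And>U V. (U, V) \<in> \<P> \<Longrightarrow> open U \<and> U \<noteq> {} \<and> open V \<and> V \<noteq> {}"
  shows "\<exists>U V. open U \<and> U \<noteq> {} \<and> open V \<and> V \<noteq> {} \<and>
           (\<forall>(U', V')\<in>\<P>. hitting_set G \<phi> U V \<subseteq> hitting_set G \<phi> U' V')"
  using assms(2,3)
proof (induction \<P> rule: finite_induct)
  case empty
  show ?case by (intro exI[of _ UNIV]) auto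
next
  case (insert P \<P>)
  obtain U' V' where P: "P = (U', V')" by fastforce
  have P': "open U'" "U' \<noteq> {}" "open V'" "V' \<noteq> {}" using insert.prems[of U' V'] P by auto
  obtain U V where UV: "open U" "U \<noteq> {}" "open V" "V \<noteq> {}"
    "\<forall>(U', V')\<in>\<P>. hitting_set G \<phi> U V \<subseteq> hitting_set G \<phi> U' V'"
    using insert.IH insert.prems by blast
  obtain a where a: "a \<in> hitting_set G \<phi> U U'" "a \<in> hitting_set G \<phi> V V'"
    using wm P' UV unfolding weakly_mixing_def by blast
  then have ac: "a \<in> carrier G" by (auto elim: hitting_setE)
  let ?U = "U \<inter> \<phi> a -` U'" and ?V = "V \<inter> \<phi> a -` V'"
  have "hitting_set G \<phi> ?U ?V \<subseteq> hitting_set G \<phi> U V"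
    by (intro hitting_set_mono) auto
  moreover have "hitting_set G \<phi> ?U ?V \<subseteq> hitting_set G \<phi> U' V'"
    using hitting_set_vimage[OF ac, of U' V'] hitting_set_mono[of ?U "\<phi> a -` U'" ?V "\<phi> a -` V'"]
    by auto
  moreover have "open ?U" "open ?V" "?U \<noteq> {}" "?V \<noteq> {}"
    using a UV(1,3) P' open_vimage_act[OF ac] by (auto elim!: hitting_setE)
  ultimately have "open ?U \<and> ?U \<noteq> {} \<and> open ?V \<and> ?V \<noteq> {} \<and>
      (\<forall>(U', V')\<in>insert P \<P>. hitting_set G \<phi> ?U ?V \<subseteq> hitting_set G \<phi> U' V')"
    using UV(5) P by (blast intro: subset_trans)
  then show ?case by blast
qed

text \<open>The new element must carry every cylinder over \<open>T\<close> into every member of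
  \<open>\<W>\<close>. These are finitely many hitting conditions, so one pair of open sets has a
  hitting set satisfying them all.\<close>

lemma independent_extend:
  assumes wm: "weakly_mixing G \<phi>"
    and \<W>: "finite \<W>" "\<And>W. W \<in> \<W> \<Longrightarrow> open W \<and> W \<noteq> {}"
    and PQ: "P \<in> \<W>" "Q \<in> \<W>" "P \<inter> Q = {}"
    and T: "finite T" "T \<subseteq> carrier G"
    and indep: "\<And>w. w \<in> T \<rightarrow> \<W> \<Longrightarrow> \<exists>x. \<forall>t\<in>T. \<phi> t x \<in> w t"
  obtains s where "s \<in> carrier G" "s \<notin> T"
    "\<And>w. w \<in> insert s T \<rightarrow> \<W> \<Longrightarrow> \<exists>x. \<forall>t\<in>insert s T. \<phi> t x \<in> w t"
proof -
  define C where "C w = (\<Inter>t\<in>T. \<phi> t -` w t)" for w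
  define \<P> where "\<P> = (\<lambda>(w, W). (C w, W)) ` ((T \<rightarrow>\<^sub>E \<W>) \<times> \<W>)"
  have "open (C w) \<and> C w \<noteq> {}" if "w \<in> T \<rightarrow>\<^sub>E \<W>" for w
  proof
    show "open (C w)"
      unfolding C_def using that T \<W>(2) by (intro open_INT ballI open_vimage_act) auto
    show "C w \<noteq> {}"
      using indep[of w] that unfolding C_def by fastforce
  qed
  then have "open U \<and> U \<noteq> {} \<and> open V \<and> V \<noteq> {}" if "(U, V) \<in> \<P>" for U V
    using that \<W>(2) unfolding \<P>_def by auto
  moreover have "finite \<P>"
    unfolding \<P>_def using T(1) \<W>(1) by (intro finite_imageI finite_cartesian_product finite_PiE) auto
  ultimately obtain U V where UV: "open U" "U \<noteq> {}" "open V" "V \<noteq> {}"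
    "\<forall>(U', V')\<in>\<P>. hitting_set G \<phi> U V \<subseteq> hitting_set G \<phi> U' V'"
    using weakly_mixing_hitting_common[OF wm, of \<P>] by metis
  obtain s where s: "s \<in> hitting_set G \<phi> U V"
    using wm UV unfolding weakly_mixing_def by blast
  have hit: "s \<in> hitting_set G \<phi> (C w) W" if "w \<in> T \<rightarrow>\<^sub>E \<W>" "W \<in> \<W>" for w W
    using s UV(5) that unfolding \<P>_def by fast
  show ?thesis
  proof (rule that)
    show "s \<in> carrier G" using s by (auto elim: hitting_setE)
    \<comment> \<open>An \<open>s\<close> in \<open>T\<close> would send a point of the cylinder
      with constant word \<open>P\<close> into \<open>P\<close>, and yet some such point is sent
      into the disjoint set \<open>Q\<close>.\<close>
    show "s \<notin> T"
    proof
      assume "s \<in> T"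
      have "s \<in> hitting_set G \<phi> (C (\<lambda>t\<in>T. P)) Q"
        using PQ by (intro hit) auto
      then obtain x where "x \<in> C (\<lambda>t\<in>T. P)" "\<phi> s x \<in> Q" by (rule hitting_setE)
      then show False using \<open>s \<in> T\<close> PQ(3) unfolding C_def by auto
    qed
    fix w assume w: "w \<in> insert s T \<rightarrow> \<W>"
    have "s \<in> hitting_set G \<phi> (C (restrict w T)) (w s)"
      using w by (intro hit) auto
    then obtain x where "x \<in> C (restrict w T)" "\<phi> s x \<in> w s" by (rule hitting_setE)
    then show "\<exists>x. \<forall>t\<in>insert s T. \<phi> t x \<in> w t"
      unfolding C_def by (intro exI[of _ x]) auto
  qed
qed

lemma infinite_independent:
  assumes wm: "weakly_mixing G \<phi>"
    and \<W>: "finite \<W>" "\<And>W. W \<in> \<W> \<Longrightarrow> open W \<and> W \<noteq> {}"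
    and PQ: "P \<in> \<W>" "Q \<in> \<W>" "P \<inter> Q = {}"
  obtains S where "S \<subseteq> carrier G" "infinite S"
    "\<And>T w. finite T \<Longrightarrow> T \<subseteq> S \<Longrightarrow> w \<in> T \<rightarrow> \<W> \<Longrightarrow> \<exists>x. \<forall>t\<in>T. \<phi> t x \<in> w t"
proof -
  define ind where "ind T \<longleftrightarrow> (\<forall>w\<in>T \<rightarrow> \<W>. \<exists>x. \<forall>t\<in>T. \<phi> t x \<in> w t)" for T
  have "\<exists>f. \<forall>n. (finite (f n) \<and> f n \<subseteq> carrier G \<and> ind (f n) \<and> card (f n) = n) \<and> f n \<subseteq> f (Suc n)"
  proof (rule dependent_nat_choice)
    show "\<exists>T. finite T \<and> T \<subseteq> carrier G \<and> ind T \<and> card T = 0"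
      by (intro exI[of _ "{}"]) (auto simp: ind_def)
    fix T n assume T: "finite T \<and> T \<subseteq> carrier G \<and> ind T \<and> card T = n"
    then obtain s where "s \<in> carrier G" "s \<notin> T" "ind (insert s T)"
      using independent_extend[OF wm \<W> PQ, of T] unfolding ind_def by (metis (no_types, lifting))
    then show "\<exists>T'. (finite T' \<and> T' \<subseteq> carrier G \<and> ind T' \<and> card T' = Suc n) \<and> T \<subseteq> T'"
      using T by (intro exI[of _ "insert s T"]) auto
  qed
  then obtain f where f: "\<And>n. finite (f n)" "\<And>n. f n \<subseteq> carrier G" "\<And>n. ind (f n)"
    "\<And>n. card (f n) = n" "\<And>n. f n \<subseteq> f (Suc n)" by blast
  let ?S = "\<Union>n. f n"
  show ?thesis
  proof (rule that)
    show "?S \<subseteq> carrier G" using f(2) by auto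
    show "infinite ?S"
    proof
      assume "finite ?S"
      then have "card (f (Suc (card ?S))) \<le> card ?S" by (intro card_mono) auto
      then show False by (simp add: f(4))
    qed
    fix T w assume T: "finite T" "T \<subseteq> ?S" and w: "w \<in> T \<rightarrow> \<W>"
    obtain n where n: "T \<subseteq> f n"
      using finite_subset_incseq[OF _ T] f(5) by (metis incseq_SucI)
    \<comment> \<open>Independence is known for words on all of \<open>f n\<close>, so the given
      word is padded with \<open>P\<close>.\<close>
    have "(\<lambda>t. if t \<in> T then w t else P) \<in> f n \<rightarrow> \<W>"
      using w PQ(1) by auto
    then obtain x where "\<forall>t\<in>f n. \<phi> t x \<in> (if t \<in> T then w t else P)"
      using f(3)[of n] unfolding ind_def by fast
    then show "\<exists>x. \<forall>t\<in>T. \<phi> t x \<in> w t" using n by (metis subsetD)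
  qed
qed

text \<open>Commutativity of \<open>G\<close> reduces four open sets to three, and the return times
  \<open>N(U, U)\<close> then reduce three to two.\<close>

lemma weakly_mixingI:
  assumes "\<And>U V. open U \<Longrightarrow> U \<noteq> {} \<Longrightarrow> open V \<Longrightarrow> V \<noteq> {} \<Longrightarrow>
             hitting_set G \<phi> U U \<inter> hitting_set G \<phi> U V \<noteq> {}"
  shows "weakly_mixing G \<phi>"
proof -
  have three: "hitting_set G \<phi> U V \<inter> hitting_set G \<phi> U W \<noteq> {}"
    if *: "open U" "U \<noteq> {}" "open V" "V \<noteq> {}" "open W" "W \<noteq> {}" for U V W
  proof -
    obtain c where c: "c \<in> hitting_set G \<phi> U V" using assms[of U V] * by blast
    then have cc: "c \<in> carrier G" by (auto elim: hitting_setE)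
    have inv: "\<phi> c (\<phi> (inv c) y) = y" for y
      using act_mult[OF cc inv_closed[OF cc], of y] cc by (simp add: act_one)
    let ?U = "U \<inter> \<phi> c -` V"
    have "open ?U" "open (\<phi> c -` W)" using * open_vimage_act[OF cc] by auto
    moreover have "?U \<noteq> {}" using c by (auto elim: hitting_setE)
    moreover have "\<phi> c -` W \<noteq> {}"
    proof -
      obtain y where "y \<in> W" using *(6) by blast
      then have "\<phi> (inv c) y \<in> \<phi> c -` W" by (simp add: inv)
      then show ?thesis by blast
    qed
    ultimately obtain h where h: "h \<in> hitting_set G \<phi> ?U ?U" "h \<in> hitting_set G \<phi> ?U (\<phi> c -` W)"
      using assms[of ?U "\<phi> c -` W"] by blast
    then have hc: "h \<in> carrier G" by (auto elim: hitting_setE)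
    \<comment> \<open>A point that \<open>h\<close> returns to \<open>?U\<close> is then sent to
      \<open>V\<close> by \<open>c\<close>; a point that \<open>h\<close> sends into the preimage of
      \<open>W\<close> is then sent to \<open>W\<close>.\<close>
    have "c \<otimes> h \<in> hitting_set G \<phi> U V" "c \<otimes> h \<in> hitting_set G \<phi> U W"
      using h act_mult[OF cc hc] cc hc
      by (auto elim!: hitting_setE intro: hitting_setI)
    then show ?thesis by blast
  qed
  show ?thesis
    unfolding weakly_mixing_def
  proof (intro allI impI, elim conjE)
    fix U1 U2 V1 V2 :: "'x set"
    assume *: "open U1" "U1 \<noteq> {}" "open U2" "U2 \<noteq> {}" "open V1" "V1 \<noteq> {}" "open V2" "V2 \<noteq> {}"
    obtain a where a: "a \<in> hitting_set G \<phi> U1 U2" using three[of U1 U2 U2] * by blast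
    then have ac: "a \<in> carrier G" by (auto elim: hitting_setE)
    have inv: "\<phi> a (\<phi> (inv a) y) = y" for y
      using act_mult[OF ac inv_closed[OF ac], of y] ac by (simp add: act_one)
    \<comment> \<open>\<open>?U\<close> serves as the source of both pairs: it lies in
      \<open>U1\<close>, and \<open>\<phi> a\<close> maps it into \<open>U2\<close>.\<close>
    let ?U = "U1 \<inter> \<phi> a -` U2"
    have "open ?U" "open (\<phi> a -` V2)" using * open_vimage_act[OF ac] by auto
    moreover have "?U \<noteq> {}" using a by (auto elim: hitting_setE)
    moreover have "\<phi> a -` V2 \<noteq> {}"
    proof -
      obtain y where "y \<in> V2" using *(8) by blast
      then have "\<phi> (inv a) y \<in> \<phi> a -` V2" by (simp add: inv)
      then show ?thesis by blast
    qed
    ultimately have "hitting_set G \<phi> ?U V1 \<inter> hitting_set G \<phi> ?U (\<phi> a -` V2) \<noteq> {}"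
      using three[of ?U V1 "\<phi> a -` V2"] * by blast
    moreover have "hitting_set G \<phi> ?U V1 \<subseteq> hitting_set G \<phi> U1 V1"
      by (intro hitting_set_mono) auto
    moreover have "hitting_set G \<phi> ?U (\<phi> a -` V2) \<subseteq> hitting_set G \<phi> U2 V2"
      using hitting_set_vimage[OF ac, of U2 V2]
        hitting_set_mono[of ?U "\<phi> a -` U2" "\<phi> a -` V2" "\<phi> a -` V2"] by auto
    ultimately show "hitting_set G \<phi> U1 V1 \<inter> hitting_set G \<phi> U2 V2 \<noteq> {}" by blast
  qed
qed

text \<open>Only the empty set and singletons can be shattered. For distinct \<open>s\<close>,
  \<open>t\<close> in a shattered set, the patterns AA and AB would put the same element
  \<open>t \<otimes> inv s\<close> into both of the disjoint hitting sets.\<close>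

lemma card_shattered_le:
  assumes T: "finite T" "T \<subseteq> carrier G"
    and AB: "A \<subseteq> U" "B \<subseteq> V" and UV: "hitting_set G \<phi> U U \<inter> hitting_set G \<phi> U V = {}"
  shows "card (shattered (\<lambda>t. \<phi> t -` A) (\<lambda>t. \<phi> t -` B) UNIV T) \<le> card T + 1"
proof -
  have "R \<in> insert {} ((\<lambda>t. {t}) ` T)"
    if R: "R \<in> shattered (\<lambda>t. \<phi> t -` A) (\<lambda>t. \<phi> t -` B) UNIV T" for R
  proof (rule ccontr)
    assume no: "R \<notin> insert {} ((\<lambda>t. {t}) ` T)"
    have RT: "R \<subseteq> T" using R unfolding shattered_def by auto
    have "\<exists>s t. s \<in> R \<and> t \<in> R \<and> s \<noteq> t"
    proof (rule ccontr)
      assume "\<not> ?thesis"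
      then have "R = {} \<or> (\<exists>t. R = {t})" by blast
      then show False using no RT by auto
    qed
    then obtain s t where st: "s \<in> R" "t \<in> R" "s \<noteq> t" by blast
    have pt: "\<exists>y. (\<forall>t\<in>Q. \<phi> t y \<in> A) \<and> (\<forall>t\<in>R - Q. \<phi> t y \<in> B)" if "Q \<subseteq> R" for Q
      using R that unfolding shattered_def by auto
    obtain y where y: "\<phi> s y \<in> A" "\<phi> t y \<in> A" using pt[of R] st by auto
    have "{s} \<subseteq> R" using st by auto
    from pt[OF this] obtain z where z: "\<phi> s z \<in> A" "\<phi> t z \<in> B" using st by auto
    have car: "s \<in> carrier G" "t \<in> carrier G" using st RT T by auto
    have eq: "\<phi> (t \<otimes> inv s) (\<phi> s x) = \<phi> t x" for x
      using act_mult[of "t \<otimes> inv s" s x] car by (simp add: m_assoc)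
    have "t \<otimes> inv s \<in> hitting_set G \<phi> U U" "t \<otimes> inv s \<in> hitting_set G \<phi> U V"
      by (rule hitting_setI[of _ "\<phi> s y"]; use y AB car eq in auto)
        (rule hitting_setI[of _ "\<phi> s z"]; use z AB car eq in auto)
    then show False using UV by blast
  qed
  then have "card (shattered (\<lambda>t. \<phi> t -` A) (\<lambda>t. \<phi> t -` B) UNIV T)
      \<le> card (insert {} ((\<lambda>t. {t}) ` T))"
    using T(1) by (intro card_mono) auto
  also have "\<dots> \<le> card T + 1"
    using card_insert_le_m1 card_image_le[OF T(1), of "\<lambda>t. {t}"] T(1)
    by (simp add: card_insert_if)
  finally show ?thesis .
qed

end

section \<open>Sequence entropy\<close>

text \<open>Every finite subset of \<open>S\<close> is eventually contained in \<open>F n\<close>.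
  Bounds for finite \<open>T \<subseteq> S\<close> depending only on \<open>card T\<close> thus pass
  to the upper limit.\<close>

lemma filterlim_card_folner:
  assumes "folner_sequence G F" "S \<subseteq> carrier G" "infinite S"
  shows "filterlim (\<lambda>n. card (S \<inter> F n)) at_top sequentially"
  unfolding filterlim_at_top
proof
  fix M
  have F: "incseq F" "\<And>n. finite (F n)" "(\<Union>n. F n) = carrier G"
    using assms(1) unfolding folner_sequence_def by (simp_all add: incseq_Suc_iff)
  obtain T where T: "T \<subseteq> S" "finite T" "card T = M"
    using infinite_arbitrarily_large[OF assms(3)] by metis
  obtain n where n: "T \<subseteq> F n"
    using finite_subset_incseq[OF F(1) T(2)] T(1) assms(2) F(3) by auto
  show "\<forall>\<^sub>F k in sequentially. M \<le> card (S \<inter> F k)"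
    using eventually_ge_at_top[of n]
  proof eventually_elim
    case (elim k)
    then have "T \<subseteq> S \<inter> F k" using n T(1) incseqD[OF F(1), of n k] by auto
    then show ?case using T(3) F(2) by (metis card_mono finite_Int)
  qed
qed

lemma seq_entropy_ge:
  assumes F: "folner_sequence G F" and S: "S \<subseteq> carrier G" "infinite S"
    and ge: "\<And>T. finite T \<Longrightarrow> T \<subseteq> S \<Longrightarrow>
      real (card T) * c \<le> ln (real (cover_number (cover_join T (\<lambda>g. pullback_cover \<phi> g \<U>))))"
  shows "ereal c \<le> seq_entropy \<phi> F S \<U>"
proof -
  have fin: "finite (S \<inter> F n)" for n
    using F unfolding folner_sequence_def by auto
  have "\<forall>\<^sub>F n in sequentially. 1 \<le> card (S \<inter> F n)"
    using filterlim_card_folner[OF F S] unfolding filterlim_at_top by blast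
  then have "\<forall>\<^sub>F n in sequentially. ereal c \<le> ereal (1 / real (card (S \<inter> F n)) *
       ln (real (cover_number (cover_join (S \<inter> F n) (\<lambda>g. pullback_cover \<phi> g \<U>)))))"
  proof eventually_elim
    case (elim n)
    then show ?case using ge[OF fin, of n] by (simp add: field_simps)
  qed
  then have "ereal c \<le> liminf (\<lambda>n. ereal (1 / real (card (S \<inter> F n)) *
       ln (real (cover_number (cover_join (S \<inter> F n) (\<lambda>g. pullback_cover \<phi> g \<U>))))))"
    by (rule Liminf_bounded)
  also have "\<dots> \<le> seq_entropy \<phi> F S \<U>"
    unfolding seq_entropy_def by (rule Liminf_le_Limsup) simp
  finally show ?thesis .
qed

lemma seq_entropy_le:
  assumes F: "folner_sequence G F" and S: "S \<subseteq> carrier G" "infinite S"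
    and le: "\<And>T. finite T \<Longrightarrow> T \<subseteq> S \<Longrightarrow> T \<noteq> {} \<Longrightarrow>
      ln (real (cover_number (cover_join T (\<lambda>g. pullback_cover \<phi> g \<U>)))) \<le> real (card T) * b (card T)"
    and b: "b \<longlonglongrightarrow> c"
  shows "seq_entropy \<phi> F S \<U> \<le> ereal c"
proof -
  have fin: "finite (S \<inter> F n)" for n
    using F unfolding folner_sequence_def by auto
  have "\<forall>\<^sub>F n in sequentially. 1 \<le> card (S \<inter> F n)"
    using filterlim_card_folner[OF F S] unfolding filterlim_at_top by blast
  then have "\<forall>\<^sub>F n in sequentially. ereal (1 / real (card (S \<inter> F n)) *
       ln (real (cover_number (cover_join (S \<inter> F n) (\<lambda>g. pullback_cover \<phi> g \<U>)))))
         \<le> ereal (b (card (S \<inter> F n)))"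
  proof eventually_elim
    case (elim n)
    then have "S \<inter> F n \<noteq> {}" by auto
    then show ?case using le[OF fin, of n] elim by (simp add: field_simps)
  qed
  then have "seq_entropy \<phi> F S \<U> \<le> limsup (\<lambda>n. ereal (b (card (S \<inter> F n))))"
    unfolding seq_entropy_def by (rule Limsup_mono)
  also have "(\<lambda>n. b (card (S \<inter> F n))) \<longlonglongrightarrow> c"
    using filterlim_compose[OF b filterlim_card_folner[OF F S]] .
  then have "limsup (\<lambda>n. ereal (b (card (S \<inter> F n)))) = ereal c"
    by (intro lim_imp_Limsup) auto
  finally show ?thesis .
qed

section \<open>Admissible, nontrivial and standard covers\<close>

lemma finite_admissible_cover:
  assumes "admissible_cover \<U>" "compact (UNIV :: 'x::topological_space set)"
  shows "finite (\<U> :: 'x set set)" "cover_number \<U> = card \<U>"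
proof -
  \<comment> \<open>Each member of an admissible cover has a point lying in no other member, so no
    subcover can omit it.\<close>
  have sub: "\<U> \<subseteq> \<V>" if "\<V> \<subseteq> \<U>" "\<Union>\<V> = UNIV" for \<V>
  proof
    fix U assume U: "U \<in> \<U>"
    then have "interior (U - \<Union>(\<U> - {U})) \<noteq> {}"
      using assms(1) unfolding admissible_cover_def by blast
    then obtain x where x: "x \<in> U" "x \<notin> \<Union>(\<U> - {U})" using interior_subset by blast
    then obtain V where "V \<in> \<V>" "x \<in> V" using \<open>\<Union>\<V> = UNIV\<close> by blast
    then show "U \<in> \<V>" using x that(1) by blast
  qed
  have cov: "\<And>U. U \<in> \<U> \<Longrightarrow> open U" "\<Union>\<U> = UNIV"
    using assms(1) unfolding admissible_cover_def open_cover_def by auto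
  obtain \<V> where "\<V> \<subseteq> \<U>" "finite \<V>" "UNIV \<subseteq> \<Union>\<V>"
    using compactE[OF assms(2), of \<U>] cov by (metis order_refl)
  then show fin: "finite \<U>" using sub[of \<V>] by (metis finite_subset top.extremum_uniqueI)
  show "cover_number \<U> = card \<U>"
    using minimal_subcover[OF fin cov(2)] sub by (metis subset_antisym)
qed

lemma nontrivial_cover_mem:
  assumes "nontrivial_cover (\<U> :: 'x::topological_space set set)"
  obtains U where "U \<in> \<U>" "U \<noteq> {}"
proof -
  have "\<Union>\<U> \<noteq> {}" using assms unfolding nontrivial_cover_def open_cover_def by auto
  then show ?thesis using that by blast
qed

text \<open>In a cover by \<open>U\<close> and \<open>V\<close>, the part of \<open>U\<close>
  outside \<open>V\<close> is \<open>- V\<close>, whose interior is nonempty because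
  \<open>V\<close> is not dense.\<close>

lemma standard_cover_admissible:
  assumes "standard_cover \<U>"
  shows "admissible_cover \<U>"
proof -
  obtain U V where \<U>: "\<U> = {U, V}" "U \<noteq> V"
    using assms unfolding standard_cover_def by (auto simp: card_2_iff)
  have cov: "open_cover \<U>" "U \<union> V = UNIV" "closure U \<noteq> UNIV" "closure V \<noteq> UNIV"
    using assms \<U> unfolding standard_cover_def nontrivial_cover_def open_cover_def by auto
  have "U - V = - V" "V - U = - U" "{U, V} - {U} = {V}" "{U, V} - {V} = {U}"
    using cov \<U> by auto
  then show ?thesis
    using cov \<U>(1) unfolding admissible_cover_def by (auto simp: interior_complement)
qed

section \<open>The implications between the four statements\<close>

context abelian_system
begin

lemma weakly_mixing_imp_admissible:
  assumes wm: "weakly_mixing G \<phi>" and inf: "infinite (carrier G)" and F: "folner_sequence G F"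
    and \<U>: "admissible_cover \<U>"
  shows "\<exists>S\<subseteq>carrier G. infinite S \<and> seq_entropy \<phi> F S \<U> = ereal (ln (real (cover_number \<U>)))"
proof -
  have "compact (UNIV :: 'x set)" using system unfolding G_system_def by simp
  from finite_admissible_cover[OF \<U> this]
  have fin: "finite \<U>" and num: "cover_number \<U> = card \<U>" .
  have cov: "\<Union>\<U> = UNIV" using \<U> unfolding admissible_cover_def open_cover_def by simp
  have pos: "card \<U> > 0" using cover_number_pos[OF fin cov] num by simp
  define W where "W U = interior (U - \<Union>(\<U> - {U}))" for U
  have W: "W U \<noteq> {}" "open (W U)" "W U \<subseteq> U - \<Union>(\<U> - {U})" if "U \<in> \<U>" for U
    using \<U> that interior_subset unfolding admissible_cover_def W_def by auto
  have "\<exists>S\<subseteq>carrier G. infinite S \<and>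
    (\<forall>T. finite T \<longrightarrow> T \<subseteq> S \<longrightarrow>
      card \<U> ^ card T \<le> cover_number (cover_join T (\<lambda>g. pullback_cover \<phi> g \<U>)))"
  proof (cases "card \<U> = 1")
    \<comment> \<open>A single member leaves no two disjoint sets to build \<open>S\<close> from,
      but the required bound is then just 1 and the whole group serves.\<close>
    case True
    have "0 < cover_number (cover_join T (\<lambda>g. pullback_cover \<phi> g \<U>))" if "finite T" for T
      by (rule cover_number_join_pos[OF that fin cov])
    then show ?thesis using True inf by (intro exI[of _ "carrier G"]) (auto simp: Suc_le_eq)
  next
    case False
    then have "\<not> card \<U> \<le> Suc 0" using pos by simp
    then obtain U V where UV: "U \<in> \<U>" "V \<in> \<U>" "U \<noteq> V"
      using fin by (auto simp: card_le_Suc0_iff_eq)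
    have disj: "W U \<inter> W V = {}" using W(3)[OF UV(1)] W(3)[OF UV(2)] UV by blast
    have WI: "open X \<and> X \<noteq> {}" if "X \<in> W ` \<U>" for X
      using that W by auto
    obtain S where S: "S \<subseteq> carrier G" "infinite S"
      "\<And>T w. finite T \<Longrightarrow> T \<subseteq> S \<Longrightarrow> w \<in> T \<rightarrow> W ` \<U> \<Longrightarrow> \<exists>x. \<forall>t\<in>T. \<phi> t x \<in> w t"
      by (rule infinite_independent[of "W ` \<U>" "W U" "W V"])
        (simp_all add: wm fin UV(1,2) WI disj)
    \<comment> \<open>\<open>W V\<close> avoids all members other than \<open>V\<close>, so the
      counting bound holds with \<open>m = 1\<close> and no word is lost.\<close>
    have one: "card {V \<in> \<U>. W V \<inter> U \<noteq> {}} \<le> 1" if "U \<in> \<U>" for U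
    proof -
      have "{V \<in> \<U>. W V \<inter> U \<noteq> {}} \<subseteq> {U}" using W(3) that by blast
      from card_mono[OF _ this] show ?thesis by simp
    qed
    have "card \<U> ^ card T \<le> cover_number (cover_join T (\<lambda>g. pullback_cover \<phi> g \<U>))"
      if "finite T" "T \<subseteq> S" for T
      using cover_number_join_ge[OF that(1) fin cov S(3)[OF that] one] by simp
    then show ?thesis using S by blast
  qed
  then obtain S where S: "S \<subseteq> carrier G" "infinite S" and ge: "\<And>T. finite T \<Longrightarrow> T \<subseteq> S \<Longrightarrow>
      card \<U> ^ card T \<le> cover_number (cover_join T (\<lambda>g. pullback_cover \<phi> g \<U>))" by blast
  have eq: "ln (real (cover_number (cover_join T (\<lambda>g. pullback_cover \<phi> g \<U>))))
      = real (card T) * ln (real (card \<U>))" if "finite T" "T \<subseteq> S" for T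
  proof -
    have "cover_number (cover_join T (\<lambda>g. pullback_cover \<phi> g \<U>)) = card \<U> ^ card T"
      using ge[OF that] cover_number_join_le[OF that(1) fin cov] by (rule antisym[rotated])
    then show ?thesis using pos by (simp add: ln_realpow)
  qed
  have "seq_entropy \<phi> F S \<U> = ereal (ln (real (card \<U>)))"
  proof (rule antisym)
    show "seq_entropy \<phi> F S \<U> \<le> ereal (ln (real (card \<U>)))"
      by (rule seq_entropy_le[OF F S _ tendsto_const]) (simp add: eq)
    show "ereal (ln (real (card \<U>))) \<le> seq_entropy \<phi> F S \<U>"
      by (rule seq_entropy_ge[OF F S]) (simp add: eq)
  qed
  then show ?thesis using S num by auto
qed

lemma weakly_mixing_imp_nontrivial:
  assumes wm: "weakly_mixing G \<phi>" and F: "folner_sequence G F"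
    and \<U>: "nontrivial_cover \<U>"
  shows "\<exists>S\<subseteq>carrier G. infinite S \<and> seq_entropy \<phi> F S \<U> > 0"
proof -
  have fin: "finite \<U>" and cov: "\<Union>\<U> = UNIV" and op: "\<And>U. U \<in> \<U> \<Longrightarrow> open U \<and> closure U \<noteq> UNIV"
    using \<U> unfolding nontrivial_cover_def open_cover_def by auto
  define W where "W U = - closure U" for U :: "'x set"
  obtain U where U: "U \<in> \<U>" "U \<noteq> {}" by (rule nontrivial_cover_mem[OF \<U>])
  obtain V where V: "V \<in> \<U>" "V \<noteq> U"
    using cov U op by (metis UNIV_I UNIV_eq_I UnionE closure_UNIV)
  have k: "card \<U> \<ge> 2"
    using card_mono[OF fin, of "{U, V}"] U V by simp
  have disj: "U \<inter> W U = {}" unfolding W_def using closure_subset by auto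
  \<comment> \<open>\<open>U\<close> joins the family only to supply the disjoint pair
    \<open>U\<close>, \<open>W U\<close>; the words counted below use the sets \<open>W V\<close>
    alone.\<close>
  have WI: "open X \<and> X \<noteq> {}" if "X \<in> insert U (W ` \<U>)" for X
    using that op U unfolding W_def by auto
  obtain S where S: "S \<subseteq> carrier G" "infinite S"
    "\<And>T w. finite T \<Longrightarrow> T \<subseteq> S \<Longrightarrow> w \<in> T \<rightarrow> insert U (W ` \<U>) \<Longrightarrow> \<exists>x. \<forall>t\<in>T. \<phi> t x \<in> w t"
    by (rule infinite_independent[of "insert U (W ` \<U>)" U "W U"])
      (simp_all add: wm fin U(1) WI disj)
  \<comment> \<open>A member never meets the complement of its own closure. This saves one letter in
    each position and yields the rate \<open>ln (k / (k - 1))\<close>.\<close>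
  have m: "card {V \<in> \<U>. W V \<inter> U \<noteq> {}} \<le> card \<U> - 1" if "U \<in> \<U>" for U
  proof -
    have "{V \<in> \<U>. W V \<inter> U \<noteq> {}} \<subseteq> \<U> - {U}"
      unfolding W_def using closure_subset by auto
    from card_mono[OF _ this] show ?thesis using fin that by (simp add: card_Diff_singleton)
  qed
  let ?k = "real (card \<U>)"
  have ge: "real (card T) * ln (?k / (?k - 1))
      \<le> ln (real (cover_number (cover_join T (\<lambda>g. pullback_cover \<phi> g \<U>))))"
    if T: "finite T" "T \<subseteq> S" for T
  proof -
    let ?N = "cover_number (cover_join T (\<lambda>g. pullback_cover \<phi> g \<U>))"
    have "card \<U> ^ card T \<le> (card \<U> - 1) ^ card T * ?N"
    proof (rule cover_number_join_ge[OF T(1) fin cov _ m])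
      fix w assume "w \<in> T \<rightarrow> W ` \<U>"
      then show "\<exists>x. \<forall>t\<in>T. \<phi> t x \<in> w t" by (intro S(3)[OF T]) auto
    qed
    then have "real (card \<U> ^ card T) \<le> real ((card \<U> - 1) ^ card T * ?N)"
      by (rule of_nat_mono)
    then have "?k ^ card T \<le> (?k - 1) ^ card T * real ?N"
      using k by (simp add: of_nat_diff)
    then have "(?k / (?k - 1)) ^ card T \<le> real ?N"
      using k by (simp add: power_divide field_simps)
    moreover have "(?k / (?k - 1)) ^ card T > 0" using k by (intro zero_less_power) auto
    ultimately have "ln ((?k / (?k - 1)) ^ card T) \<le> ln (real ?N)" by (intro ln_mono) auto
    then show ?thesis using k by (simp add: ln_realpow)
  qed
  have "0 < ereal (ln (?k / (?k - 1)))" using k by (simp add: field_simps)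
  also have "\<dots> \<le> seq_entropy \<phi> F S \<U>" by (rule seq_entropy_ge[OF F S(1,2) ge])
  finally show ?thesis using S by blast
qed

lemma standard_imp_weakly_mixing:
  assumes F: "folner_sequence G F"
    and std: "\<And>\<U>. standard_cover \<U> \<Longrightarrow> \<exists>S\<subseteq>carrier G. infinite S \<and> seq_entropy \<phi> F S \<U> > 0"
  shows "weakly_mixing G \<phi>"
proof (rule weakly_mixingI, rule notI)
  fix U V assume op: "open U" "U \<noteq> {}" "open V" "V \<noteq> {}"
    and no: "hitting_set G \<phi> U U \<inter> hitting_set G \<phi> U V = {}"
  have UV: "U \<inter> V = {}"
  proof (rule ccontr)
    assume "U \<inter> V \<noteq> {}"
    then obtain x where "x \<in> U" "x \<in> V" by blast
    then have "\<one> \<in> hitting_set G \<phi> U U" "\<one> \<in> hitting_set G \<phi> U V"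
      by (auto intro!: hitting_setI simp: act_one)
    then show False using no by blast
  qed
  obtain a r where a: "r > 0" "cball a r \<subseteq> U"
    using op(1,2) open_contains_cball by (metis all_not_in_conv)
  obtain b q where b: "q > 0" "cball b q \<subseteq> V"
    using op(3,4) open_contains_cball by (metis all_not_in_conv)
  let ?A = "cball a r" and ?B = "cball b q"
  have AB: "?A \<inter> ?B = {}" using a b UV by blast
  have aA: "a \<in> ?A" using a by simp
  have ne: "- ?A \<noteq> - ?B" using AB aA by blast
  have int: "interior (cball c e) \<noteq> {}" if "e > 0" for c :: 'x and e
    using that ball_subset_cball[of c e] interior_maximal[OF ball_subset_cball open_ball, of c e]
    by (metis centre_in_ball empty_iff subsetD)
  \<comment> \<open>Closed balls have open complements; disjointness makes these a cover, and the
    nonempty interiors keep them from being dense.\<close>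
  have "standard_cover {- ?A, - ?B}"
    unfolding standard_cover_def nontrivial_cover_def open_cover_def
    using AB ne int[OF a(1), of a] int[OF b(1), of b] by (auto simp: closure_complement)
  from std[OF this] obtain S where S: "S \<subseteq> carrier G" "infinite S"
    and pos: "seq_entropy \<phi> F S {- ?A, - ?B} > 0" by blast
  \<comment> \<open>The rate from \<open>card T + 1\<close> raised to an exponent of at most
    \<open>log 2 (card T + 2) + 1\<close>: it is of order log squared of n over n.\<close>
  define \<beta> where "\<beta> n = (log 2 (real n + 2) + 1) * ln (real n + 1) / real n" for n
  have "seq_entropy \<phi> F S {- ?A, - ?B} \<le> ereal 0"
  proof (rule seq_entropy_le[OF F S])
    show "\<beta> \<longlonglongrightarrow> 0" unfolding \<beta>_def by real_asymp
    fix T assume T: "finite T" "T \<subseteq> S" "T \<noteq> {}"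
    let ?N = "cover_number (cover_join T (\<lambda>g. pullback_cover \<phi> g {- ?A, - ?B}))"
    \<comment> \<open>The summand 2 makes \<open>2 ^ j\<close> strictly exceed
      \<open>card T + 1\<close>, the bound on the number of shattered sets.\<close>
    define j where "j = nat \<lceil>log 2 (real (card T) + 2)\<rceil>"
    have j: "log 2 (real (card T) + 2) \<le> real j" "real j \<le> log 2 (real (card T) + 2) + 1"
      unfolding j_def by (auto simp: of_nat_nat ceiling_le_iff)
    have "real (card T) + 2 \<le> 2 ^ j"
      using j(1) by (subst (asm) log_le_iff) (auto simp: powr_realpow)
    then have "real (card T + 1) < real (2 ^ j)" by simp
    then have "card T + 1 < 2 ^ j" by (simp only: of_nat_less_iff)
    then have "card (shattered (\<lambda>t. \<phi> t -` ?A) (\<lambda>t. \<phi> t -` ?B) UNIV T) < 2 ^ j"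
      using card_shattered_le[OF T(1) _ a(2) b(2) no] T(2) S(1) by fastforce
    from cover_number_join_le_shattered[OF T(1) AB this]
    have "real ?N \<le> real ((card T + 1) ^ j)" by (rule of_nat_mono)
    moreover have "?N > 0" using AB by (intro cover_number_join_pos T(1)) auto
    ultimately have "ln (real ?N) \<le> ln (real ((card T + 1) ^ j))" by (intro ln_mono) auto
    also have "\<dots> = real j * ln (real (card T) + 1)" by (simp add: ln_realpow add.commute)
    also have "\<dots> \<le> (log 2 (real (card T) + 2) + 1) * ln (real (card T) + 1)"
      using j(2) by (intro mult_right_mono) auto
    also have "\<dots> = real (card T) * \<beta> (card T)" using T unfolding \<beta>_def by simp
    finally show "ln (real ?N) \<le> real (card T) * \<beta> (card T)" .
  qed
  then show False using pos by (simp add: zero_ereal_def)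
qed

end

theorem theorem4p2:
  fixes G :: "('g, 'b) monoid_scheme"
    and F :: "nat \<Rightarrow> 'g set"
    and \<phi> :: "'g \<Rightarrow> 'x \<Rightarrow> 'x::metric_space"
  assumes "comm_group G"
    and "infinite (carrier G)"
    and "countable (carrier G)"
    and "folner_sequence G F"
    and "G_system G \<phi>"
  defines "stmt1 \<equiv> weakly_mixing G \<phi>"
    and "stmt2 \<equiv> (\<forall>\<U>. admissible_cover \<U> \<longrightarrow>
           (\<exists>S \<subseteq> carrier G. infinite S \<and> seq_entropy \<phi> F S \<U> = ereal (ln (real (cover_number \<U>)))))"
    and "stmt3 \<equiv> (\<forall>\<U>. nontrivial_cover \<U> \<longrightarrow>
           (\<exists>S \<subseteq> carrier G. infinite S \<and> seq_entropy \<phi> F S \<U> > 0))"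
    and "stmt4 \<equiv> (\<forall>\<U>. standard_cover \<U> \<longrightarrow>
           (\<exists>S \<subseteq> carrier G. infinite S \<and> seq_entropy \<phi> F S \<U> > 0))"
  shows "(stmt1 \<longleftrightarrow> stmt2) \<and> (stmt2 \<longleftrightarrow> stmt3) \<and> (stmt3 \<longleftrightarrow> stmt4)"
proof -
  interpret abelian_system G \<phi>
    using assms(1,5) by (simp add: abelian_system_def abelian_system_axioms_def)
  have 12: "stmt1 \<Longrightarrow> stmt2"
    unfolding stmt1_def stmt2_def using weakly_mixing_imp_admissible assms(2,4) by blast
  have 13: "stmt1 \<Longrightarrow> stmt3"
    unfolding stmt1_def stmt3_def using weakly_mixing_imp_nontrivial assms(4) by blast
  have 34: "stmt3 \<Longrightarrow> stmt4"
    unfolding stmt3_def stmt4_def standard_cover_def by blast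
  have 41: "stmt4 \<Longrightarrow> stmt1"
    unfolding stmt4_def stmt1_def using standard_imp_weakly_mixing[OF assms(4)] by blast
  \<comment> \<open>A standard cover is admissible with cover number 2, so (2) gives it entropy
    \<open>ln 2\<close>. Together with 1-3-4-1 and 1-2 this closes all equivalences.\<close>
  have 24: "stmt2 \<Longrightarrow> stmt4"
    unfolding stmt4_def
  proof (intro allI impI)
    fix \<U> :: "'x set set" assume stmt2 and std: "standard_cover \<U>"
    have adm: "admissible_cover \<U>" by (rule standard_cover_admissible[OF std])
    have "compact (UNIV :: 'x set)" using assms(5) unfolding G_system_def by simp
    then have "cover_number \<U> = 2"
      using finite_admissible_cover(2)[OF adm] std unfolding standard_cover_def by simp
    then show "\<exists>S\<subseteq>carrier G. infinite S \<and> seq_entropy \<phi> F S \<U> > 0"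
      using \<open>stmt2\<close> adm unfolding stmt2_def by (metis ereal_less(2) ln_gt_zero of_nat_numeral one_less_numeral_iff semiring_norm(76))
  qed
  show ?thesis using 12 13 34 41 24 by blast
qed

end
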